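(* Let $\Omega$ be a compact metric space, $T:\Omega\to\Omega$ a homeomorphism, and $A:\Omega\to\mathrm{SL}(2,\mathbb{R})$ a continuous map. Then $(T,A)$ is not uniformly hyperbolic if and only if there exist $\omega\in\Omega$ and a unit vector $\vec v\in\mathbb{R}^2$ such that $$\|A_n(\omega)\vec v\|\le 1\quad\text{for all } n\in\mathbb{Z}.$$
   Context: For a set $\Omega$, a bijection $T:\Omega\to\Omega$ and a bounded map $A:\Omega\to\mathrm{SL}(2,\mathbb{R})$, let $(T,A)(\omega,\vec v)=(T\omega,A(\omega)\vec v)$ on $\Omega\times\mathbb{R}^2$, with iterates $(T,A)^n=(T^n,A_n)$: $A_n(\omega)=A(T^{n-1}\omega)\cdots A(\omega)$ for $n\ge1$, $A_0(\omega)=I_2$, and $A_n(\omega)=[A_{-n}(T^{n}\omega)]^{-1}$ for $n\le-1$. $\|\cdot\|$ on $\mathbb{R}^2$ is the Euclidean norm. $\mathbb{RP}^1=\mathbb{R}/(\pi\mathbb{Z})$ is the set of lines through the origin of $\mathbb{R}^2$ (identified with angles), $B\cdot\theta$ is the induced action of $B\in\mathrm{SL}(2,\mathbb{R})$, and $\vec v\in\theta$ means $\vec v$ lies on the line $\theta$. $(T,A)$ is uniformly hyperbolic if there are maps $u,s:\Omega\to\mathbb{RP}^1$ (no regularity required) such that (1) $A(\omega)\cdot u(\omega)=u(T\omega)$ and $A(\omega)\cdot s(\omega)=s(T\omega)$ for all $\omega\in\Omega$; (2) there exist $C>0$, $\lambda>1$ such that $\|A_{-n}(\omega)\vec v\|\le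 C\lambda^{-n}$ and $\|A_n(\omega)\vec w\|\le C\lambda^{-n}$ for all $n\ge1$, all $\omega\in\Omega$ and all unit vectors $\vec v\in u(\omega)$, $\vec w\in s(\omega)$. *)

theory Defs
  imports "HOL-Analysis.Analysis"
begin

text \<open>
  The base space is a carrier set \<open>\<Omega>\<close>; maps on \<open>\<Omega>\<close> are total functions whose values outside \<open>\<Omega>\<close>
  are irrelevant. In particular the inverse of a bijection \<open>T\<close> of \<open>\<Omega>\<close> is \<open>inv_into \<Omega> T\<close>.
\<close>

definition SL2 :: "(real^2^2) set" where
  "SL2 = {B. det B = 1}"

definition int_iterate :: "'a set \<Rightarrow> ('a \<Rightarrow> 'a) \<Rightarrow> int \<Rightarrow> 'a \<Rightarrow> 'a" where
  "int_iterate \<Omega> T n = (if 0 \<le> n then T ^^ nat n else inv_into \<Omega> T ^^ nat (- n))"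

primrec forward_cocycle :: "('a \<Rightarrow> 'a) \<Rightarrow> ('a \<Rightarrow> real^2^2) \<Rightarrow> nat \<Rightarrow> 'a \<Rightarrow> real^2^2" where
  "forward_cocycle T A 0 \<omega> = mat 1"
| "forward_cocycle T A (Suc n) \<omega> = A ((T ^^ n) \<omega>) ** forward_cocycle T A n \<omega>"

definition cocycle :: "'a set \<Rightarrow> ('a \<Rightarrow> 'a) \<Rightarrow> ('a \<Rightarrow> real^2^2) \<Rightarrow> int \<Rightarrow> 'a \<Rightarrow> real^2^2" where
  "cocycle \<Omega> T A n \<omega> =
     (if 0 \<le> n then forward_cocycle T A (nat n) \<omega>
      else matrix_inv (forward_cocycle T A (nat (- n)) (int_iterate \<Omega> T n \<omega>)))"

text \<open>
  A point of the projective line is represented by the line itself, as a set of vectors; the induced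
  action of a matrix is the image of the line under it.
\<close>

definition RP1 :: "(real^2) set set" where
  "RP1 = {L. subspace L \<and> dim L = 1}"

definition proj_action :: "real^2^2 \<Rightarrow> (real^2) set \<Rightarrow> (real^2) set" where
  "proj_action B L = (\<lambda>v. B *v v) ` L"

definition uniformly_hyperbolic :: "'a set \<Rightarrow> ('a \<Rightarrow> 'a) \<Rightarrow> ('a \<Rightarrow> real^2^2) \<Rightarrow> bool" where
  "uniformly_hyperbolic \<Omega> T A \<longleftrightarrow>
     (\<exists>u \<in> \<Omega> \<rightarrow> RP1. \<exists>s \<in> \<Omega> \<rightarrow> RP1.
        (\<forall>\<omega>\<in>\<Omega>. proj_action (A \<omega>) (u \<omega>) = u (T \<omega>) \<and> proj_action (A \<omega>) (s \<omega>) = s (T \<omega>)) \<and>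
        (\<exists>C>0. \<exists>l>1. \<forall>n::int. n \<ge> 1 \<longrightarrow> (\<forall>\<omega>\<in>\<Omega>.
           (\<forall>v\<in>u \<omega>. norm v = 1 \<longrightarrow> norm (cocycle \<Omega> T A (- n) \<omega> *v v) \<le> C * l powi (- n)) \<and>
           (\<forall>w\<in>s \<omega>. norm w = 1 \<longrightarrow> norm (cocycle \<Omega> T A n \<omega> *v w) \<le> C * l powi (- n)))))"

end

theory Submission
  imports Defs
begin

text \<open>
  If no unit vector has an orbit bounded by 1, compactness yields \<open>N\<close> and \<open>\<mu> > 1\<close> such that along every
  orbit the norm grows by the factor \<open>\<mu>\<close> within \<open>N\<close> steps, forwards or backwards. So norms have no local
  maxima at scale \<open>N\<close>, and in the middle of a time interval they are exponentially smaller than at one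
  of its ends. Vectors with bounded forward orbit therefore decay exponentially. They form a line:
  not the whole plane since determinants are 1, and not zero since a limit of unit vectors \<open>v\<^sub>n\<close>
  with \<open>\<parallel>A\<^sub>n v\<^sub>n\<parallel> \<le> 1\<close> has a bounded forward orbit. Time reversal gives the unstable line.
  Conversely, for a uniformly hyperbolic cocycle the stable and unstable lines are transversal, and
  a nonzero component along either makes the orbit unbounded.
\<close>

section \<open>Real 2x2 matrices of determinant one\<close>

text \<open>Cayley-Hamilton with determinant 1 reads B^2 - (trace B) B + I = 0. Since
  \<open>mat (trace B)\<close> is a scalar matrix, the second factor is the adjugate of
  \<open>B\<close>.\<close>

lemma SL2_cayley_hamilton:
  fixes B :: "real^2^2"
  assumes "det B = 1"
  shows "B ** (mat (trace B) - B) = mat 1" and "(mat (trace B) - B) ** B = mat 1"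
proof -
  have d: "B$1$1 * B$2$2 = 1 + B$1$2 * B$2$1"
    using assms by (simp add: det_2)
  show "B ** (mat (trace B) - B) = mat 1"
    using d by (simp add: vec_eq_iff matrix_matrix_mult_def forall_2 sum_2 mat_def trace_def algebra_simps)
  then show "(mat (trace B) - B) ** B = mat 1"
    using matrix_left_right_inverse by blast
qed

text \<open>\<open>matrix_inv\<close> is a Hilbert choice, so the adjugate serves as witness that
  the choice is an inverse; uniqueness of inverses then identifies the two.\<close>

lemma SL2_inv:
  fixes B :: "real^2^2"
  assumes "det B = 1"
  shows "B ** matrix_inv B = mat 1" and "matrix_inv B ** B = mat 1"
    and "matrix_inv B = mat (trace B) - B"
proof -
  have inv: "B ** matrix_inv B = mat 1 \<and> matrix_inv B ** B = mat 1"
    unfolding matrix_inv_def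
    by (rule someI[of _ "mat (trace B) - B"]) (use SL2_cayley_hamilton[OF assms] in blast)
  then show "B ** matrix_inv B = mat 1" "matrix_inv B ** B = mat 1" by auto
  then show "matrix_inv B = mat (trace B) - B"
    using matrix_mul_assoc[of "mat (trace B) - B" B "matrix_inv B"] SL2_cayley_hamilton[OF assms]
    by simp
qed

text \<open>Hadamard's inequality: the determinant is at most the product of the lengths of the
  columns, and the columns are the images of the basis vectors.\<close>

lemma SL2_image_axis_ge_1:
  fixes B :: "real^2^2"
  assumes "det B = 1"
  shows "\<exists>i. norm (B *v axis i 1) \<ge> 1"
proof (rule ccontr)
  assume *: "\<not> ?thesis"
  have less: "(B$1$i)\<^sup>2 + (B$2$i)\<^sup>2 < 1" for i
  proof -
    have "(norm (B *v axis i 1))\<^sup>2 < 1"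
      using * by (auto simp: abs_square_less_1 not_le)
    then show ?thesis
      by (simp add: matrix_vector_mult_basis column_def norm_vec_def L2_set_def sum_2)
  qed
  have "1 = (B$1$1 * B$2$2 - B$1$2 * B$2$1)\<^sup>2"
    using assms by (simp add: det_2)
  also have "\<dots> \<le> ((B$1$1)\<^sup>2 + (B$2$1)\<^sup>2) * ((B$1$2)\<^sup>2 + (B$2$2)\<^sup>2)"
  proof -
    \<comment> \<open>Lagrange's identity in the plane; the square that is dropped is that of the
      inner product of the columns.\<close>
    have "((B$1$1)\<^sup>2 + (B$2$1)\<^sup>2) * ((B$1$2)\<^sup>2 + (B$2$2)\<^sup>2) =
      (B$1$1 * B$2$2 - B$1$2 * B$2$1)\<^sup>2 + (B$1$1 * B$1$2 + B$2$1 * B$2$2)\<^sup>2"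
      by algebra
    then show ?thesis by simp
  qed
  also have "\<dots> < 1"
    using mult_strict_mono'[OF less[of 1] less[of 2]] by simp
  finally show False by simp
qed

text \<open>The inverse takes some basis vector to a vector \<open>w\<close> of norm at least 1. As
  \<open>B\<close> takes \<open>w\<close> back to a unit vector, normalizing \<open>w\<close> gives
  \<open>v\<close>.\<close>

lemma SL2_unit_vector_not_expanded:
  fixes B :: "real^2^2"
  assumes "det B = 1"
  obtains v where "norm v = 1" and "norm (B *v v) \<le> 1"
proof -
  note inv = SL2_inv[OF assms]
  have "det (matrix_inv B) = 1"
    using inv(1) assms by (metis det_I det_mul mult_1)
  then obtain i where i: "norm (matrix_inv B *v axis i 1) \<ge> 1"
    using SL2_image_axis_ge_1 by blast
  define w where "w = matrix_inv B *v axis i 1"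
  have Bw: "B *v w = axis i 1"
    by (simp add: w_def matrix_vector_mul_assoc inv(1))
  have w: "norm w \<ge> 1" using i by (simp add: w_def)
  show thesis
  proof
    show "norm (w /\<^sub>R norm w) = 1" using w by (cases "w = 0") auto
    have "norm (B *v (w /\<^sub>R norm w)) = 1 / norm w"
      by (simp add: matrix_vector_mult_scaleR Bw inverse_eq_divide)
    also have "\<dots> \<le> 1" using w by (simp add: divide_le_eq_1)
    finally show "norm (B *v (w /\<^sub>R norm w)) \<le> 1" .
  qed
qed

section \<open>Growth of sequences without local maxima, and the stable line of one orbit\<close>

text \<open>A maximum of \<open>a\<close> on \<open>{i..j}\<close> must lie within \<open>N\<close> of an endpoint.\<close>

lemma no_local_max_growth:
  fixes a :: "int \<Rightarrow> real" and N :: int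
  assumes nonneg: "\<And>k. a k \<ge> 0" and mu: "\<mu> > 1"
    and jump: "\<And>k. \<exists>l. \<bar>l - k\<bar> \<le> N \<and> a l \<ge> \<mu> * a k"
    and lip: "\<And>k l. \<bar>l - k\<bar> \<le> N \<Longrightarrow> a l \<le> D * a k"
    and ij: "i \<le> m - int k * N" "m + int k * N \<le> j"
  shows "\<mu> ^ k * a m \<le> D * max (a i) (a j)"
proof -
  have N: "N \<ge> 0" using jump[of 0] by (auto intro: order_trans[OF abs_ge_zero])
  \<comment> \<open>Taking \<open>l = k\<close> in \<open>lip\<close> gives
    \<open>a k \<le> D * a k\<close>, which excludes a negative \<open>D\<close> as soon as
    \<open>a k\<close> is positive.\<close>
  have D: "D \<ge> 0" if "a k > 0" for k
    using lip[of k k] N that nonneg[of k] by (smt (verit) mult_neg_pos)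
  \<comment> \<open>Following \<open>jump\<close> for \<open>k\<close> rounds gains the factor
    \<open>\<mu> ^ k\<close> and drifts at most \<open>int k * N\<close> from \<open>m\<close>,
    hence stays inside \<open>{i..j}\<close>.\<close>
  have up: "\<exists>q. \<bar>q - m\<bar> \<le> int k * N \<and> \<mu> ^ k * a m \<le> a q" for k
  proof (induction k)
    case (Suc k)
    then obtain q where q: "\<bar>q - m\<bar> \<le> int k * N" "\<mu> ^ k * a m \<le> a q" by blast
    obtain l where l: "\<bar>l - q\<bar> \<le> N" "a l \<ge> \<mu> * a q" using jump by blast
    have "\<mu> ^ Suc k * a m \<le> a l"
      using mult_left_mono[OF q(2), of \<mu>] mu l(2) unfolding power_Suc mult.assoc by linarith
    moreover have "\<bar>l - m\<bar> \<le> int (Suc k) * N"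
      using q(1) l(1) by (simp add: distrib_right)
    ultimately show ?case by blast
  qed auto
  obtain q where q: "\<bar>q - m\<bar> \<le> int k * N" "\<mu> ^ k * a m \<le> a q" using up by blast
  have qin: "q \<in> {i..j}" using q ij by auto
  define M where "M = Max (a ` {i..j})"
  have "M \<in> a ` {i..j}" unfolding M_def using qin by (intro Max_in) auto
  then obtain p where p: "p \<in> {i..j}" "a p = M" by auto
  have le_M: "a x \<le> M" if "x \<in> {i..j}" for x using that by (simp add: M_def)
  have "a p \<le> D * max (a i) (a j)"
  proof (cases "a p > 0")
    case False
    then have "a i = 0" "a j = 0" "a p = 0"
      using p nonneg[of p] nonneg[of i] nonneg[of j] le_M[of i] le_M[of j] by auto
    then show ?thesis by simp
  next
    case True
    obtain l where l: "\<bar>l - p\<bar> \<le> N" "a l \<ge> \<mu> * a p" using jump by blast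
    \<comment> \<open>The value at \<open>l\<close> exceeds the maximum, so \<open>l\<close> lies
      outside the interval and \<open>p\<close> is within \<open>N\<close> of the endpoint that was
      crossed.\<close>
    have "a l > a p" using l(2) mult_strict_right_mono[OF mu True] by simp
    then have "l \<notin> {i..j}" using le_M[of l] p(2) by linarith
    then have "\<bar>p - i\<bar> \<le> N \<or> \<bar>p - j\<bar> \<le> N"
      using l(1) p(1) unfolding atLeastAtMost_iff by linarith
    then have "a p \<le> D * a i \<or> a p \<le> D * a j" using lip by blast
    then show ?thesis
      using mult_left_mono[OF max.cobounded1 D[OF True], of "a i" "a j"]
        mult_left_mono[OF max.cobounded2 D[OF True], of "a j" "a i"] by linarith
  qed
  then show ?thesis using q(2) le_M[OF qin] p by linarith
qed

text \<open>\<open>P\<close> stands for the cocycle along a single orbit, read in either time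
  direction, so that one argument yields both the stable and the unstable line. \<open>jump\<close>
  and \<open>lip\<close> are what compactness will provide.\<close>

locale no_local_max_orbit =
  fixes P :: "int \<Rightarrow> real^2^2" and N :: nat and \<mu> D :: real
  assumes det_P: "det (P n) = 1" and P_0: "P 0 = mat 1"
    and N_pos: "N > 0" and mu: "\<mu> > 1" and D: "D > 0"
    and jump: "\<exists>l. \<bar>l - k\<bar> \<le> int N \<and> norm (P l *v v) \<ge> \<mu> * norm (P k *v v)"
    and lip: "\<bar>l - k\<bar> \<le> int N \<Longrightarrow> norm (P l *v v) \<le> D * norm (P k *v v)"
begin

lemma growth:
  assumes "i \<le> m - int k * int N" "m + int k * int N \<le> j"
  shows "\<mu> ^ k * norm (P m *v v) \<le> D * max (norm (P i *v v)) (norm (P j *v v))"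
  by (rule no_local_max_growth[where a = "\<lambda>n. norm (P n *v v)"])
    (use assms mu jump lip in auto)

text \<open>Convergence to 0 makes closure under linear combinations immediate;
  \<open>bounded_imp_stable\<close> links it to bounded forward orbits.\<close>

definition stable :: "(real^2) set" where
  "stable = {v. (\<lambda>n. P (int n) *v v) \<longlonglongrightarrow> 0}"

text \<open>\<open>growth\<close> is applied from time 0 to a time \<open>j\<close> so late that the
  norm there is below \<open>norm v\<close>; the larger endpoint value is then the initial
  norm.\<close>

lemma stable_decay_blocks:
  assumes "v \<in> stable" and "k * N \<le> n"
  shows "\<mu> ^ k * norm (P (int n) *v v) \<le> D * norm v"
proof (cases "v = 0")
  case False
  have "(\<lambda>n. norm (P (int n) *v v)) \<longlonglongrightarrow> 0"
    using assms(1) by (simp add: stable_def tendsto_norm_zero)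
  then have "\<forall>\<^sub>F j in sequentially. norm (P (int j) *v v) < norm v"
    by (rule order_tendstoD) (use False in simp)
  \<comment> \<open>\<open>j\<close> must also leave \<open>k\<close> blocks of length
    \<open>N\<close> to the right of \<open>n\<close>.\<close>
  then have "\<forall>\<^sub>F j in sequentially. norm (P (int j) *v v) < norm v \<and> n + k * N \<le> j"
    by (intro eventually_conj eventually_ge_at_top)
  then obtain j where j: "norm (P (int j) *v v) < norm v" "n + k * N \<le> j"
    by (auto simp: eventually_sequentially)
  have "int (k * N) \<le> int n" "int (n + k * N) \<le> int j"
    using assms(2) j(2) by linarith+
  then have "\<mu> ^ k * norm (P (int n) *v v)
      \<le> D * max (norm (P 0 *v v)) (norm (P (int j) *v v))"
    by (intro growth) (auto simp: algebra_simps)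
  then show ?thesis using j(1) by (simp add: P_0)
qed simp

text \<open>The growth per single step: \<open>N\<close> steps at this rate amount to one factor
  \<open>\<mu>\<close>.\<close>

definition rate :: real where "rate = root N \<mu>"

lemma rate_gt_1: "rate > 1"
  unfolding rate_def using mu N_pos by simp

text \<open>The factor \<open>\<mu>\<close> in the constant pays for rounding \<open>n\<close> down
  to whole blocks of length \<open>N\<close>.\<close>

lemma stable_decay:
  assumes "v \<in> stable"
  shows "norm (P (int n) *v v) \<le> D * \<mu> * rate powi (- int n) * norm v"
proof -
  define k where "k = n div N"
  have "rate ^ n \<le> rate ^ ((k + 1) * N)"
    using rate_gt_1 N_pos dividend_less_div_times[of N n]
    by (intro power_increasing) (auto simp: k_def)
  also have "\<dots> = \<mu> ^ (k + 1)"
    using mu N_pos by (metis less_eq_real_def less_trans mult.commute power_mult rate_def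
        real_root_pow_pos2 zero_less_one)
  finally have "rate ^ n * norm (P (int n) *v v) \<le> \<mu> * (\<mu> ^ k * norm (P (int n) *v v))"
    by (metis add.commute mult.assoc mult_right_mono norm_ge_zero plus_1_eq_Suc power_Suc)
  also have "\<dots> \<le> \<mu> * (D * norm v)"
    using mu by (intro mult_left_mono stable_decay_blocks assms) (auto simp: k_def)
  finally show ?thesis
    using rate_gt_1 by (simp add: power_int_minus field_simps)
qed

text \<open>Time \<open>n\<close> is the middle of the interval from 0 to \<open>n + n\<close>, with
  \<open>n div N\<close> blocks on each side and norms at most \<open>K\<close> at both
  ends.\<close>

lemma bounded_imp_stable:
  assumes "\<And>n. norm (P (int n) *v v) \<le> K"
  shows "v \<in> stable"
proof -
  have K: "K \<ge> 0" using assms[of 0] norm_ge_zero order_trans by blast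
  have "norm (P (int n) *v v) \<le> D * K * inverse \<mu> ^ (n div N)" for n
  proof -
    have le: "int (n div N) * int N \<le> int n"
      by (metis div_times_less_eq_dividend of_nat_le_iff of_nat_mult)
    have "\<mu> ^ (n div N) * norm (P (int n) *v v)
        \<le> D * max (norm (P 0 *v v)) (norm (P (int (n + n)) *v v))"
      by (rule growth) (use le in \<open>simp_all\<close>)
    also have "\<dots> \<le> D * K"
      using D assms[of 0] assms[of "n + n"] by simp
    finally show ?thesis
      using mu by (simp add: field_simps)
  qed
  moreover have "(\<lambda>n. D * K * inverse \<mu> ^ (n div N)) \<longlonglongrightarrow> D * K * 0"
  proof (intro tendsto_mult tendsto_const)
    have "filterlim (\<lambda>n. n div N) at_top sequentially"
      using N_pos by (intro filterlim_at_top_div_const_nat) auto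
    moreover have "(\<lambda>n. inverse \<mu> ^ n) \<longlonglongrightarrow> 0"
      using mu by (intro LIMSEQ_power_zero) (simp add: inverse_less_1_iff)
    ultimately show "(\<lambda>n. inverse \<mu> ^ (n div N)) \<longlonglongrightarrow> 0"
      by (rule filterlim_compose[rotated])
  qed
  ultimately show ?thesis
    unfolding stable_def using Lim_null_comparison[OF always_eventually] by force
qed

lemma subspace_stable: "subspace stable"
proof (rule subspaceI)
  show "x + y \<in> stable" if "x \<in> stable" "y \<in> stable" for x y
    using tendsto_add_zero[of "\<lambda>n. P (int n) *v x" _ "\<lambda>n. P (int n) *v y"] that
    by (simp add: stable_def matrix_vector_right_distrib)
  show "c *\<^sub>R x \<in> stable" if "x \<in> stable" for c x
    using tendsto_scaleR[OF tendsto_const[of c], of "\<lambda>n. P (int n) *v x" 0] that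
    by (simp add: stable_def matrix_vector_mult_scaleR)
qed (simp add: stable_def)

text \<open>If every vector decayed, so would all matrix entries and with them the determinant,
  which is constantly 1.\<close>

lemma stable_neq_UNIV: "stable \<noteq> UNIV"
proof
  assume *: "stable = UNIV"
  have entry: "(\<lambda>n. P (int n) $ i $ j) \<longlonglongrightarrow> 0" for i j
  proof -
    have "(\<lambda>n. P (int n) *v axis j 1) \<longlonglongrightarrow> 0" using * by (auto simp: stable_def)
    from tendsto_vec_nth[OF this, of i] show ?thesis
      by (simp add: matrix_vector_mult_basis column_def)
  qed
  have "(\<lambda>n. det (P (int n))) \<longlonglongrightarrow> 0 * 0 - 0 * 0"
    unfolding det_2 by (intro tendsto_intros entry)
  then show False by (simp add: det_P LIMSEQ_const_iff)
qed

lemma ex_unit_stable: "\<exists>v\<in>stable. norm v = 1"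
proof -
  have "\<exists>v. norm v = 1 \<and> norm (P (int n) *v v) \<le> 1" for n
    using SL2_unit_vector_not_expanded[OF det_P] by metis
  then obtain v where v: "\<And>n. norm (v n) = 1" "\<And>n. norm (P (int n) *v v n) \<le> 1"
    by metis
  obtain l r where l: "l \<in> sphere 0 1" "strict_mono r" "(v \<circ> r) \<longlonglongrightarrow> l"
    using compact_sphere[of "0::real^2" 1] v(1) unfolding compact_def
    by (metis dist_0_norm mem_sphere)
  have "norm (P (int m) *v l) \<le> D" for m
  proof (rule tendsto_upperbound)
    show "(\<lambda>n. norm (P (int m) *v v (r n))) \<longlonglongrightarrow> norm (P (int m) *v l)"
      using l(3) by (intro tendsto_norm bounded_linear.tendsto[OF matrix_vector_mul_bounded_linear])
        (simp add: o_def)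
    \<comment> \<open>With \<open>k = 0\<close>, \<open>growth\<close> is a maximum principle up to
      the factor \<open>D\<close>. The interval from 0 to \<open>r n\<close> contains
      \<open>m\<close>, and the norms at its ends are at most 1.\<close>
    have "norm (P (int m) *v v (r n)) \<le> D" if "m \<le> n" for n
    proof -
      have "m \<le> r n" using that seq_suble[OF l(2), of n] by linarith
      then have "norm (P (int m) *v v (r n)) \<le>
          D * max (norm (P 0 *v v (r n))) (norm (P (int (r n)) *v v (r n)))"
        using growth[of 0 "int m" 0 "int (r n)"] by simp
      also have "\<dots> = D" using v(1)[of "r n"] v(2)[of "r n"] by (simp add: P_0 max_absorb1)
      finally show ?thesis .
    qed
    then show "\<forall>\<^sub>F n in sequentially. norm (P (int m) *v v (r n)) \<le> D"
      by (auto simp: eventually_sequentially)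
  qed auto
  then have "l \<in> stable" by (rule bounded_imp_stable)
  then show ?thesis using l(1) by auto
qed

lemma stable_in_RP1: "stable \<in> RP1"
proof -
  have "dim stable \<noteq> 0"
    using ex_unit_stable by auto
  moreover have "dim stable \<noteq> 2"
    using stable_neq_UNIV dim_eq_full[of stable] span_eq_iff[of stable] subspace_stable by force
  moreover have "dim stable \<le> 2"
    using dim_subset_UNIV[of stable] by simp
  ultimately have "dim stable = 1" by linarith
  then show ?thesis using subspace_stable by (simp add: RP1_def)
qed

end

section \<open>Continuity and cancellation for matrix products\<close>

lemma continuous_on_matrix_matrix_mult [continuous_intros]:
  fixes f :: "'a::topological_space \<Rightarrow> real^'n^'m" and g :: "'a \<Rightarrow> real^'k^'n"
  assumes "continuous_on S f" and "continuous_on S g"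
  shows "continuous_on S (\<lambda>x. f x ** g x)"
  unfolding matrix_matrix_mult_def by (intro continuous_intros assms)

lemma continuous_on_matrix_vector_mult [continuous_intros]:
  fixes f :: "'a::topological_space \<Rightarrow> real^'n^'m" and g :: "'a \<Rightarrow> real^'n"
  assumes "continuous_on S f" and "continuous_on S g"
  shows "continuous_on S (\<lambda>x. f x *v g x)"
  unfolding matrix_vector_mult_def by (intro continuous_intros assms)

text \<open>On determinant 1 the inverse is \<open>mat (trace B) - B\<close>, whose entries are
  linear in those of \<open>B\<close>.\<close>

lemma continuous_on_SL2_inv:
  fixes f :: "'a::topological_space \<Rightarrow> real^2^2"
  assumes "continuous_on S f" and "\<And>x. x \<in> S \<Longrightarrow> det (f x) = 1"
  shows "continuous_on S (\<lambda>x. matrix_inv (f x))"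
proof -
  have "continuous_on S (\<lambda>x. if i = j then trace (f x) else 0)" for i j :: 2
    unfolding trace_def by (cases "i = j") (auto intro!: continuous_intros assms)
  then have "continuous_on S (\<lambda>x. (\<chi> i j. if i = j then trace (f x) else 0) - f x)"
    by (intro continuous_intros assms)
  then show ?thesis
    by (rule continuous_on_eq) (simp add: SL2_inv(3) assms mat_def)
qed

lemma SL2_vec_cancel:
  fixes B :: "real^2^2"
  assumes "det B = 1" and "B *v x = B *v y"
  shows "x = y"
  using SL2_inv(2)[OF assms(1)] assms(2)
  by (metis matrix_vector_mul_assoc matrix_vector_mul_lid)

lemma continuous_on_funpow:
  assumes "continuous_on S f" and "f \<in> S \<rightarrow> S"
  shows "continuous_on S (f ^^ n) \<and> (f ^^ n) \<in> S \<rightarrow> S"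
proof (induction n)
  case (Suc n)
  then show ?case
    using assms continuous_on_compose2[OF assms(1), of S "f ^^ n"] by (auto simp: o_def)
qed auto

section \<open>Algebra of the cocycle over integer times\<close>

locale sl2_cocycle =
  fixes \<Omega> :: "'a set" and T :: "'a \<Rightarrow> 'a" and A :: "'a \<Rightarrow> real^2^2"
  assumes bij: "bij_betw T \<Omega> \<Omega>" and SL2: "A \<in> \<Omega> \<rightarrow> SL2"
begin

abbreviation iter :: "int \<Rightarrow> 'a \<Rightarrow> 'a" where "iter \<equiv> int_iterate \<Omega> T"
abbreviation \<Phi> :: "int \<Rightarrow> 'a \<Rightarrow> real^2^2" where "\<Phi> \<equiv> cocycle \<Omega> T A"

lemma T_in: "\<omega> \<in> \<Omega> \<Longrightarrow> T \<omega> \<in> \<Omega>"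
  using bij bij_betw_apply by metis

lemma inv_T_in: "\<omega> \<in> \<Omega> \<Longrightarrow> inv_into \<Omega> T \<omega> \<in> \<Omega>"
  using bij_betw_inv_into[OF bij] bij_betw_apply by metis

lemma iter_in: "\<omega> \<in> \<Omega> \<Longrightarrow> iter n \<omega> \<in> \<Omega>"
proof -
  assume "\<omega> \<in> \<Omega>"
  then have "(T ^^ k) \<omega> \<in> \<Omega> \<and> (inv_into \<Omega> T ^^ k) \<omega> \<in> \<Omega>" for k
    by (induction k) (auto simp: T_in inv_T_in)
  then show ?thesis by (simp add: int_iterate_def)
qed

lemma iter_0: "iter 0 \<omega> = \<omega>"
  by (simp add: int_iterate_def)

lemma iter_Suc:
  assumes "\<omega> \<in> \<Omega>"
  shows "iter (n + 1) \<omega> = T (iter n \<omega>)"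
proof (cases "0 \<le> n")
  case True
  then show ?thesis by (simp add: int_iterate_def nat_add_distrib)
next
  case False
  then obtain k where n: "n = - int (Suc k)"
    by (metis int_cases not_le of_nat_0_le_iff)
  have "(inv_into \<Omega> T ^^ k) \<omega> \<in> \<Omega>"
    by (induction k) (auto simp: assms inv_T_in)
  \<comment> \<open>\<open>T\<close> undoes the outermost \<open>inv_into \<Omega> T\<close> because
    the point below it lies in \<open>\<Omega>\<close>.\<close>
  then have "T (iter n \<omega>) = (inv_into \<Omega> T ^^ k) \<omega>"
    using bij_betw_inv_into_right[OF bij] by (simp add: int_iterate_def n nat_add_distrib)
  also have "\<dots> = iter (n + 1) \<omega>"
    by (simp add: int_iterate_def n)
  finally show ?thesis ..
qed

lemma iter_add:
  assumes "\<omega> \<in> \<Omega>"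
  shows "iter (m + n) \<omega> = iter m (iter n \<omega>)"
proof (induction m rule: int_induct[of _ 0])
  case base
  then show ?case by (simp add: iter_0)
next
  case (step1 i)
  then show ?case
    using iter_Suc[OF assms, of "i + n"] iter_Suc[OF iter_in[OF assms], of i n]
    by (simp add: algebra_simps)
next
  case (step2 i)
  \<comment> \<open>The downward step is verified after applying \<open>T\<close>, which is then
    cancelled by injectivity on \<open>\<Omega>\<close>.\<close>
  then have "T (iter (i - 1 + n) \<omega>) = T (iter (i - 1) (iter n \<omega>))"
    using iter_Suc[OF assms, of "i - 1 + n"] iter_Suc[OF iter_in[OF assms], of "i - 1" n]
    by (simp add: algebra_simps)
  then show ?case
    using bij assms iter_in unfolding bij_betw_def inj_on_def by metis
qed

lemma det_A: "\<omega> \<in> \<Omega> \<Longrightarrow> det (A \<omega>) = 1"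
  using SL2 by (auto simp: SL2_def Pi_iff)

lemma det_forward_cocycle: "\<omega> \<in> \<Omega> \<Longrightarrow> det (forward_cocycle T A n \<omega>) = 1"
proof (induction n)
  case (Suc n)
  then show ?case using iter_in[of \<omega> "int n"] by (simp add: det_mul det_A int_iterate_def)
qed simp

lemma det_\<Phi>:
  assumes "\<omega> \<in> \<Omega>"
  shows "det (\<Phi> n \<omega>) = 1"
proof -
  have "det (matrix_inv B) = 1" if "det B = 1" for B :: "real^2^2"
    using SL2_inv(1)[OF that] that by (metis det_I det_mul mult_1)
  then show ?thesis
    using assms by (simp add: cocycle_def det_forward_cocycle iter_in)
qed

lemma \<Phi>_0: "\<Phi> 0 \<omega> = mat 1"
  by (simp add: cocycle_def)

text \<open>The recursion adds the latest factor on the left. At negative times it is the base point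
  that moves, so the earliest factor has to be split off on the right.\<close>

lemma forward_cocycle_Suc_shift:
  "forward_cocycle T A (Suc n) \<omega> = forward_cocycle T A n (T \<omega>) ** A \<omega>"
proof (induction n)
  case (Suc n)
  have "forward_cocycle T A (Suc (Suc n)) \<omega> =
      A ((T ^^ Suc n) \<omega>) ** forward_cocycle T A (Suc n) \<omega>" by simp
  also have "\<dots> = A ((T ^^ n) (T \<omega>)) ** (forward_cocycle T A n (T \<omega>) ** A \<omega>)"
    unfolding Suc.IH by (simp add: funpow_swap1)
  finally show ?case by (simp add: matrix_mul_assoc)
qed simp

text \<open>For \<open>n = - int (Suc k)\<close> the value is the inverse of
  \<open>F ** A \<eta>\<close>, and multiplying by \<open>A \<eta>\<close> leaves the inverse of
  \<open>F\<close>, which covers the remaining \<open>k\<close> steps.\<close>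

lemma \<Phi>_Suc:
  assumes "\<omega> \<in> \<Omega>"
  shows "\<Phi> (n + 1) \<omega> = A (iter n \<omega>) ** \<Phi> n \<omega>"
proof (cases "0 \<le> n")
  case True
  then show ?thesis by (simp add: cocycle_def int_iterate_def nat_add_distrib)
next
  case False
  then obtain k where n: "n = - int (Suc k)"
    by (metis int_cases not_le of_nat_0_le_iff)
  define \<eta> where "\<eta> = iter n \<omega>"
  have \<eta>: "\<eta> \<in> \<Omega>" "T \<eta> \<in> \<Omega>" using assms by (auto simp: \<eta>_def iter_in T_in)
  have T\<eta>: "T \<eta> = iter (n + 1) \<omega>" by (simp add: \<eta>_def iter_Suc assms)
  define F where "F = forward_cocycle T A k (T \<eta>)"
  have detF: "det F = 1" by (simp add: F_def det_forward_cocycle \<eta>)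
  have eq: "\<Phi> n \<omega> = matrix_inv (F ** A \<eta>)"
    using forward_cocycle_Suc_shift[of k \<eta>]
    by (simp add: cocycle_def n F_def \<eta>_def nat_add_distrib)
  have "F ** (A \<eta> ** \<Phi> n \<omega>) = mat 1"
    unfolding eq matrix_mul_assoc by (intro SL2_inv) (simp add: det_mul detF det_A \<eta>)
  then have "matrix_inv F ** (F ** (A \<eta> ** \<Phi> n \<omega>)) = matrix_inv F" by simp
  then have "A \<eta> ** \<Phi> n \<omega> = matrix_inv F"
    unfolding matrix_mul_assoc by (simp add: SL2_inv(2)[OF detF])
  also have "matrix_inv F = \<Phi> (n + 1) \<omega>"
  \<comment> \<open>For \<open>k = 0\<close> the time \<open>n + 1\<close> is 0 and falls under the
    nonnegative branch of \<open>cocycle\<close>, with \<open>F\<close> the identity.\<close>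
  proof (cases "k = 0")
    case True
    then show ?thesis using SL2_inv(1)[OF detF] by (simp add: F_def \<Phi>_0 n)
  next
    case False
    then show ?thesis unfolding F_def T\<eta> by (simp add: cocycle_def n)
  qed
  finally show ?thesis unfolding \<eta>_def ..
qed

text \<open>The cocycle identity, by induction on \<open>m\<close> in both directions; downwards,
  both sides agree after applying the same invertible matrix.\<close>

lemma \<Phi>_add:
  assumes "\<omega> \<in> \<Omega>"
  shows "\<Phi> m (iter n \<omega>) *v (\<Phi> n \<omega> *v v) = \<Phi> (m + n) \<omega> *v v"
proof (induction m rule: int_induct[of _ 0])
  case base
  then show ?case by (simp add: \<Phi>_0)
next
  case (step1 i)
  then show ?case
    using \<Phi>_Suc[OF assms, of "i + n"] \<Phi>_Suc[OF iter_in[OF assms], of i n]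
      iter_add[OF assms, of i n]
    by (simp add: algebra_simps flip: matrix_vector_mul_assoc)
next
  case (step2 i)
  have "A (iter (i - 1 + n) \<omega>) *v (\<Phi> (i - 1) (iter n \<omega>) *v (\<Phi> n \<omega> *v v)) =
      \<Phi> i (iter n \<omega>) *v (\<Phi> n \<omega> *v v)"
    using \<Phi>_Suc[OF iter_in[OF assms], of "i - 1" n] iter_add[OF assms, of "i - 1" n]
    by (simp flip: matrix_vector_mul_assoc)
  also have "\<dots> = A (iter (i - 1 + n) \<omega>) *v (\<Phi> (i - 1 + n) \<omega> *v v)"
    using step2 \<Phi>_Suc[OF assms, of "i - 1 + n"] by (simp add: matrix_vector_mul_assoc)
  finally show ?case
    by (rule SL2_vec_cancel[rotated]) (simp add: det_A iter_in assms)
qed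

lemma \<Phi>_cancel:
  assumes "\<omega> \<in> \<Omega>"
  shows "\<Phi> (- n) (iter n \<omega>) *v (\<Phi> n \<omega> *v v) = v"
  using \<Phi>_add[OF assms, of "- n" n v] by (simp add: \<Phi>_0)

lemma \<Phi>_in_invariant_field:
  assumes inv: "\<And>\<omega>. \<omega> \<in> \<Omega> \<Longrightarrow> proj_action (A \<omega>) (u \<omega>) = u (T \<omega>)"
    and \<omega>: "\<omega> \<in> \<Omega>" and v: "v \<in> u \<omega>"
  shows "\<Phi> n \<omega> *v v \<in> u (iter n \<omega>)"
proof (induction n rule: int_induct[of _ 0])
  case base
  then show ?case using v by (simp add: \<Phi>_0 iter_0)
next
  case (step1 i)
  then have "A (iter i \<omega>) *v (\<Phi> i \<omega> *v v) \<in> u (T (iter i \<omega>))"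
    using inv[OF iter_in[OF \<omega>, of i]] by (auto simp: proj_action_def)
  then show ?case by (simp add: iter_Suc \<Phi>_Suc \<omega> matrix_vector_mul_assoc)
next
  case (step2 i)
  let ?\<eta> = "iter (i - 1) \<omega>"
  have "A ?\<eta> *v (\<Phi> (i - 1) \<omega> *v v) \<in> u (T ?\<eta>)"
    using step2 \<Phi>_Suc[OF \<omega>, of "i - 1"] iter_Suc[OF \<omega>, of "i - 1"]
    by (simp add: matrix_vector_mul_assoc)
  \<comment> \<open>Invariance is an equality of lines, so the vector has a preimage on the earlier
    line, and injectivity identifies that preimage.\<close>
  then obtain x where "x \<in> u ?\<eta>" "A ?\<eta> *v (\<Phi> (i - 1) \<omega> *v v) = A ?\<eta> *v x"
    unfolding inv[OF iter_in[OF \<omega>], symmetric] proj_action_def by blast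
  then show ?case
    using SL2_vec_cancel[OF det_A[OF iter_in[OF \<omega>]]] by metis
qed

section \<open>Uniform hyperbolicity excludes bounded orbits\<close>

text \<open>The sign \<open>\<sigma>\<close> selects the time direction: 1 for the unstable and -1 for the stable field.\<close>

lemma bounded_orbit_in_contracted_field:
  assumes inv: "\<And>\<omega>. \<omega> \<in> \<Omega> \<Longrightarrow> proj_action (A \<omega>) (u \<omega>) = u (T \<omega>)"
    and sub: "\<And>\<omega>. \<omega> \<in> \<Omega> \<Longrightarrow> subspace (u \<omega>)"
    and l: "l > 1" and C: "C > 0"
    and dec: "\<And>n \<omega> v. n \<ge> 1 \<Longrightarrow> \<omega> \<in> \<Omega> \<Longrightarrow> v \<in> u \<omega> \<Longrightarrow> norm v = 1 \<Longrightarrow>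
      norm (\<Phi> (\<sigma> * - n) \<omega> *v v) \<le> C * l powi (- n)"
    and \<omega>: "\<omega> \<in> \<Omega>" and a: "a \<in> u \<omega>"
    and bdd: "\<And>n. n \<ge> 1 \<Longrightarrow> norm (\<Phi> (\<sigma> * n) \<omega> *v a) \<le> K"
  shows "a = 0"
proof -
  have dec': "norm (\<Phi> (\<sigma> * - n) \<eta> *v v) \<le> C * l powi (- n) * norm v"
    if "n \<ge> 1" "\<eta> \<in> \<Omega>" "v \<in> u \<eta>" for n \<eta> v
  proof (cases "v = 0")
    case False
    have "norm (\<Phi> (\<sigma> * - n) \<eta> *v (v /\<^sub>R norm v)) \<le> C * l powi (- n)"
      using that False by (intro dec subspace_scale sub) auto
    then show ?thesis
      using False by (simp add: matrix_vector_mult_scaleR field_simps)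
  qed simp
  have "norm a \<le> C * K * inverse l ^ Suc k" for k
  proof -
    let ?n = "int (Suc k)" and ?\<eta> = "iter (\<sigma> * int (Suc k)) \<omega>"
    \<comment> \<open>\<open>a\<close> is recovered by pulling its image at time
      \<open>\<sigma> * ?n\<close> back along the field: the image is bounded by \<open>K\<close>
      and the pullback contracts exponentially.\<close>
    have "norm a = norm (\<Phi> (\<sigma> * - ?n) ?\<eta> *v (\<Phi> (\<sigma> * ?n) \<omega> *v a))"
      using \<Phi>_cancel[OF \<omega>, of "\<sigma> * ?n" a] by (simp only: mult_minus_right)
    also have "\<dots> \<le> C * l powi (- ?n) * norm (\<Phi> (\<sigma> * ?n) \<omega> *v a)"
      by (rule dec') (use iter_in \<omega> \<Phi>_in_invariant_field[OF inv \<omega> a] in auto)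
    also have "\<dots> \<le> C * l powi (- ?n) * K"
      using C l by (intro mult_left_mono bdd) auto
    also have "\<dots> = C * K * inverse l ^ Suc k"
      by (simp only: power_int_minus power_int_of_nat power_inverse mult_ac)
    finally show ?thesis .
  qed
  moreover have "(\<lambda>k. C * K * inverse l ^ Suc k) \<longlonglongrightarrow> C * K * 0"
    using l by (intro tendsto_mult tendsto_const LIMSEQ_Suc LIMSEQ_power_zero)
      (simp add: inverse_less_1_iff)
  ultimately have "norm a \<le> C * K * 0"
    by (intro LIMSEQ_le_const) auto
  then show ?thesis by simp
qed

lemma uniformly_hyperbolic_imp_no_bounded_orbit:
  assumes "uniformly_hyperbolic \<Omega> T A" and \<omega>: "\<omega> \<in> \<Omega>"
    and bdd: "\<And>n. norm (\<Phi> n \<omega> *v v) \<le> K"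
  shows "v = 0"
proof -
  from assms(1) obtain u s where us: "u \<in> \<Omega> \<rightarrow> RP1" "s \<in> \<Omega> \<rightarrow> RP1"
    and inv: "\<forall>\<omega>\<in>\<Omega>. proj_action (A \<omega>) (u \<omega>) = u (T \<omega>) \<and> proj_action (A \<omega>) (s \<omega>) = s (T \<omega>)"
    and ex: "\<exists>C>0. \<exists>l>1. \<forall>n\<ge>1. \<forall>\<omega>\<in>\<Omega>.
      (\<forall>v\<in>u \<omega>. norm v = 1 \<longrightarrow> norm (\<Phi> (- n) \<omega> *v v) \<le> C * l powi (- n)) \<and>
      (\<forall>w\<in>s \<omega>. norm w = 1 \<longrightarrow> norm (\<Phi> n \<omega> *v w) \<le> C * l powi (- n))"
    unfolding uniformly_hyperbolic_def by (elim bexE conjE) (rule that; assumption)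
  from ex obtain C l where C: "C > 0" and l: "l > 1"
    and dec: "\<forall>n\<ge>1. \<forall>\<omega>\<in>\<Omega>.
      (\<forall>v\<in>u \<omega>. norm v = 1 \<longrightarrow> norm (\<Phi> (- n) \<omega> *v v) \<le> C * l powi (- n)) \<and>
      (\<forall>w\<in>s \<omega>. norm w = 1 \<longrightarrow> norm (\<Phi> n \<omega> *v w) \<le> C * l powi (- n))"
    by (elim exE conjE) (rule that; assumption)
  have sub: "subspace (u \<eta>)" "subspace (s \<eta>)" "dim (u \<eta>) = 1" "dim (s \<eta>) = 1" if "\<eta> \<in> \<Omega>" for \<eta>
    using us that by (auto simp: RP1_def Pi_iff)
  have u0: "a = 0" if "a \<in> u \<omega>" "\<And>n. n \<ge> 1 \<Longrightarrow> norm (\<Phi> n \<omega> *v a) \<le> K" for a K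
    using bounded_orbit_in_contracted_field[of u l C 1 \<omega> a K] inv sub(1) l C dec \<omega> that
    by simp
  have s0: "a = 0" if "a \<in> s \<omega>" "\<And>n. n \<ge> 1 \<Longrightarrow> norm (\<Phi> (- n) \<omega> *v a) \<le> K" for a K
    using bounded_orbit_in_contracted_field[of s l C "-1" \<omega> a K] inv sub(2) l C dec \<omega> that
    by simp
  \<comment> \<open>The decay is weakened to a bound uniform in \<open>n\<close> and extended from
    unit vectors to the whole line.\<close>
  have scaled: "norm (B *v a) \<le> C * norm a"
    if "\<And>v. v \<in> L \<Longrightarrow> norm v = 1 \<Longrightarrow> norm (B *v v) \<le> C * l powi (- n)" "n \<ge> 1" "subspace L" "a \<in> L"
    for B :: "real^2^2" and a L n
  proof (cases "a = 0")
    case False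
    have "norm (B *v (a /\<^sub>R norm a)) \<le> C * l powi (- n)"
      using that False by (intro that(1) subspace_scale) auto
    also have "l powi (- n) \<le> 1"
      using l that(2) power_int_increasing[of "- n" 0 l] by simp
    then have "C * l powi (- n) \<le> C" using C by simp
    finally show ?thesis
      using False by (simp add: matrix_vector_mult_scaleR field_simps)
  qed simp
  have u_bdd: "norm (\<Phi> (- n) \<omega> *v a) \<le> C * norm a" if "n \<ge> 1" "a \<in> u \<omega>" for n a
    using scaled[of "u \<omega>" "\<Phi> (- n) \<omega>" n] dec \<omega> sub(1) that by blast
  have s_bdd: "norm (\<Phi> n \<omega> *v a) \<le> C * norm a" if "n \<ge> 1" "a \<in> s \<omega>" for n a
    using scaled[of "s \<omega>" "\<Phi> n \<omega>" n] dec \<omega> sub(2) that by blast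
  \<comment> \<open>A common vector has a bounded forward orbit because it lies in
    \<open>s \<omega>\<close>, and so vanishes because it lies in \<open>u \<omega>\<close>.\<close>
  have "u \<omega> \<inter> s \<omega> \<subseteq> {0}"
    using u0 s_bdd by blast
  then have "dim (u \<omega> \<inter> s \<omega>) = 0" by simp
  then have "dim {x + y |x y. x \<in> u \<omega> \<and> y \<in> s \<omega>} = 2"
    using dim_sums_Int[OF sub(1,2)[OF \<omega>]] sub(3,4)[OF \<omega>] by (simp del: dim_eq_0)
  then have "{x + y |x y. x \<in> u \<omega> \<and> y \<in> s \<omega>} = UNIV"
    using dim_eq_full[of "{x + y |x y. x \<in> u \<omega> \<and> y \<in> s \<omega>}"]
      span_eq_iff[THEN iffD2, OF subspace_sums[OF sub(1,2)[OF \<omega>]]]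
    by (simp del: span_eq_iff)
  then obtain a b where ab: "a \<in> u \<omega>" "b \<in> s \<omega>" "v = a + b" by blast
  \<comment> \<open>In forward time the stable component \<open>b\<close> stays bounded, so
    boundedness of \<open>v\<close> passes to \<open>a\<close>. Once \<open>a = 0\<close>, the
    backward orbit of \<open>b\<close> is that of \<open>v\<close>.\<close>
  have "norm (\<Phi> n \<omega> *v a) \<le> K + C * norm b" if "n \<ge> 1" for n
    using bdd[of n] s_bdd[OF that ab(2)] norm_diff_ineq[of "\<Phi> n \<omega> *v a" "\<Phi> n \<omega> *v b"]
    by (simp add: ab(3) matrix_vector_right_distrib)
  then have "a = 0" using u0 ab(1) by blast
  moreover have "norm (\<Phi> (- n) \<omega> *v b) \<le> K" if "n \<ge> 1" for n
    using bdd[of "- n"] \<open>a = 0\<close> by (simp add: ab(3))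
  then have "b = 0" using s0 ab(2) by blast
  ultimately show ?thesis by (simp add: ab(3))
qed

end

section \<open>Uniform estimates from compactness\<close>

locale continuous_sl2_cocycle = sl2_cocycle \<Omega> T A
  for \<Omega> :: "'a::metric_space set" and T :: "'a \<Rightarrow> 'a" and A :: "'a \<Rightarrow> real^2^2" +
  assumes compact: "compact \<Omega>"
    and cont_T: "continuous_on \<Omega> T" and cont_inv_T: "continuous_on \<Omega> (inv_into \<Omega> T)"
    and cont_A: "continuous_on \<Omega> A"
begin

lemma continuous_on_iter: "continuous_on \<Omega> (iter n)"
  unfolding int_iterate_def
  using continuous_on_funpow[OF cont_T] continuous_on_funpow[OF cont_inv_T] T_in inv_T_in
  by simp

lemma continuous_on_forward_cocycle: "continuous_on \<Omega> (forward_cocycle T A n)"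
proof (induction n)
  case (Suc n)
  have "continuous_on \<Omega> (\<lambda>\<omega>. A (iter (int n) \<omega>))"
    using iter_in by (intro continuous_on_compose2[OF cont_A continuous_on_iter]) auto
  with Suc show ?case
    unfolding forward_cocycle.simps by (intro continuous_intros) (simp_all add: int_iterate_def)
qed simp

lemma continuous_on_\<Phi>: "continuous_on \<Omega> (\<Phi> n)"
proof (cases "0 \<le> n")
  case True
  then show ?thesis
    unfolding cocycle_def by (simp add: continuous_on_forward_cocycle)
next
  case False
  have "continuous_on \<Omega> (\<lambda>\<omega>. matrix_inv (forward_cocycle T A (nat (- n)) (iter n \<omega>)))"
    using iter_in
    by (intro continuous_on_SL2_inv continuous_on_compose2[OF continuous_on_forward_cocycle
          continuous_on_iter] det_forward_cocycle) auto
  with False show ?thesis unfolding cocycle_def by simp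
qed

lemma continuous_on_norm_orbit:
  "continuous_on (\<Omega> \<times> UNIV) (\<lambda>p. norm (\<Phi> n (fst p) *v snd p))"
  by (intro continuous_intros continuous_on_compose2[OF continuous_on_\<Phi>]) auto

lemma uniformly_bounded_\<Phi>:
  obtains D where "D > 0"
    and "\<And>n \<omega> v. \<bar>n\<bar> \<le> N \<Longrightarrow> \<omega> \<in> \<Omega> \<Longrightarrow> norm (\<Phi> n \<omega> *v v) \<le> D * norm v"
proof -
  have "\<exists>d. \<forall>\<omega>\<in>\<Omega>. \<forall>v. norm v = 1 \<longrightarrow> norm (\<Phi> n \<omega> *v v) \<le> d" for n
  proof -
    let ?f = "\<lambda>p. norm (\<Phi> n (fst p) *v snd p)"
    have "bounded (?f ` (\<Omega> \<times> sphere 0 1))"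
      by (intro compact_imp_bounded compact_continuous_image compact_Times compact compact_sphere
          continuous_on_subset[OF continuous_on_norm_orbit]) auto
    then obtain d where "\<forall>p\<in>\<Omega> \<times> sphere 0 1. ?f p \<le> d"
      unfolding bounded_iff by auto
    then show ?thesis by (intro exI[of _ d]) auto
  qed
  then obtain d where d: "\<And>n \<omega> v. \<omega> \<in> \<Omega> \<Longrightarrow> norm v = 1 \<Longrightarrow> norm (\<Phi> n \<omega> *v v) \<le> d n"
    by metis
  \<comment> \<open>The sum dominates each of the finitely many bounds. Absolute values and the 1
    ensure positivity even for empty \<open>\<Omega>\<close>, where \<open>d\<close> is
    arbitrary.\<close>
  define D where "D = 1 + (\<Sum>n\<in>{-N..N}. \<bar>d n\<bar>)"
  show thesis
  proof
    show "D > 0" unfolding D_def by (smt (verit) sum_nonneg abs_ge_zero)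
    fix n \<omega> and v :: "real^2" assume n: "\<bar>n\<bar> \<le> N" and \<omega>: "\<omega> \<in> \<Omega>"
    have "\<bar>d n\<bar> \<le> (\<Sum>n\<in>{-N..N}. \<bar>d n\<bar>)"
      using n by (intro member_le_sum) auto
    then have dD: "d n \<le> D" unfolding D_def by linarith
    show "norm (\<Phi> n \<omega> *v v) \<le> D * norm v"
    proof (cases "v = 0")
      case False
      have "norm (\<Phi> n \<omega> *v (v /\<^sub>R norm v)) \<le> d n"
        using False by (intro d \<omega>) auto
      then have "norm (\<Phi> n \<omega> *v v) \<le> d n * norm v"
        using False by (simp add: matrix_vector_mult_scaleR field_simps)
      also have "\<dots> \<le> D * norm v" using dD by (simp add: mult_right_mono)
      finally show ?thesis .
    qed simp
  qed
qed

text \<open>Otherwise, for every \<open>k\<close> some unit vector stays below 1 + 1/(k+1) over the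
  time window of radius k+1; a limit of such vectors has its whole orbit bounded by 1.\<close>

lemma uniform_escape:
  assumes "\<not> (\<exists>\<omega>\<in>\<Omega>. \<exists>v. norm v = 1 \<and> (\<forall>n. norm (\<Phi> n \<omega> *v v) \<le> 1))"
  obtains N :: nat and \<mu> :: real where "N > 0" "\<mu> > 1"
    "\<And>\<omega> v. \<omega> \<in> \<Omega> \<Longrightarrow> \<exists>n. \<bar>n\<bar> \<le> int N \<and> norm (\<Phi> n \<omega> *v v) \<ge> \<mu> * norm v"
proof -
  have "\<exists>k. \<forall>\<omega>\<in>\<Omega>. \<forall>v. norm v = 1 \<longrightarrow>
      (\<exists>n. \<bar>n\<bar> \<le> int (Suc k) \<and> norm (\<Phi> n \<omega> *v v) \<ge> 1 + inverse (real (Suc k)))"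
  proof (rule ccontr)
    assume *: "\<not> ?thesis"
    have "\<exists>p\<in>\<Omega> \<times> sphere 0 1. \<forall>n. \<bar>n\<bar> \<le> int (Suc k) \<longrightarrow>
        norm (\<Phi> n (fst p) *v snd p) < 1 + inverse (real (Suc k))" for k
    proof -
      from * obtain \<omega> v where "\<omega> \<in> \<Omega>" "norm v = 1" "\<And>n. \<bar>n\<bar> \<le> int (Suc k) \<Longrightarrow>
          norm (\<Phi> n \<omega> *v v) < 1 + inverse (real (Suc k))"
        by (metis not_le)
      then show ?thesis by (intro bexI[of _ "(\<omega>, v)"]) auto
    qed
    then obtain p where p: "\<And>k. p k \<in> \<Omega> \<times> sphere 0 1"
      "\<And>k n. \<bar>n\<bar> \<le> int (Suc k) \<Longrightarrow> norm (\<Phi> n (fst (p k)) *v snd (p k)) < 1 + inverse (real (Suc k))"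
      by metis
    have "compact (\<Omega> \<times> sphere (0::real^2) 1)"
      by (intro compact_Times compact compact_sphere)
    with p(1) obtain q r where q: "q \<in> \<Omega> \<times> sphere 0 1" "strict_mono r" "(p \<circ> r) \<longlonglongrightarrow> q"
      unfolding compact_def by metis
    have "norm (\<Phi> n (fst q) *v snd q) \<le> 1" for n
    proof (rule tendsto_le)
      show "(\<lambda>k. norm (\<Phi> n (fst (p (r k))) *v snd (p (r k)))) \<longlonglongrightarrow> norm (\<Phi> n (fst q) *v snd q)"
        by (rule continuous_on_tendsto_compose[OF continuous_on_norm_orbit])
          (use q p(1) in \<open>auto simp: o_def mem_Times_iff\<close>)
      show "(\<lambda>k. 1 + inverse (real (Suc (r k)))) \<longlonglongrightarrow> 1"
        using LIMSEQ_subseq_LIMSEQ[OF LIMSEQ_inverse_real_of_nat_add[of 1] q(2)]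
        by (simp add: o_def)
      \<comment> \<open>A fixed time \<open>n\<close> lies in all windows from
        \<open>k = nat \<bar>n\<bar>\<close> on, since \<open>r k \<ge> k\<close>.\<close>
      have "norm (\<Phi> n (fst (p (r k))) *v snd (p (r k))) \<le> 1 + inverse (real (Suc (r k)))"
        if "nat \<bar>n\<bar> \<le> k" for k
        using p(2)[of n "r k"] that seq_suble[OF q(2), of k] by linarith
      then show "\<forall>\<^sub>F k in sequentially.
          norm (\<Phi> n (fst (p (r k))) *v snd (p (r k))) \<le> 1 + inverse (real (Suc (r k)))"
        unfolding eventually_sequentially by blast
    qed auto
    with assms q(1) show False by (auto simp: mem_Times_iff)
  qed
  then obtain k where k: "\<And>\<omega> v. \<omega> \<in> \<Omega> \<Longrightarrow> norm v = 1 \<Longrightarrow>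
      \<exists>n. \<bar>n\<bar> \<le> int (Suc k) \<and> norm (\<Phi> n \<omega> *v v) \<ge> 1 + inverse (real (Suc k))"
    by blast
  show thesis
  proof (rule that[of "Suc k" "1 + inverse (real (Suc k))"])
    fix \<omega> and v :: "real^2" assume \<omega>: "\<omega> \<in> \<Omega>"
    show "\<exists>n. \<bar>n\<bar> \<le> int (Suc k) \<and> norm (\<Phi> n \<omega> *v v) \<ge> (1 + inverse (real (Suc k))) * norm v"
    proof (cases "v = 0")
      case False
      then obtain n where n: "\<bar>n\<bar> \<le> int (Suc k)"
        "norm (\<Phi> n \<omega> *v (v /\<^sub>R norm v)) \<ge> 1 + inverse (real (Suc k))"
        using k[OF \<omega>, of "v /\<^sub>R norm v"] by auto
      have "norm (\<Phi> n \<omega> *v (v /\<^sub>R norm v)) = norm (\<Phi> n \<omega> *v v) / norm v"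
        using False by (simp add: matrix_vector_mult_scaleR divide_inverse_commute)
      with n False show ?thesis by (intro exI[of _ n]) (simp add: pos_le_divide_eq)
    qed (auto intro: exI[of _ 0])
  qed auto
qed

section \<open>Construction of the invariant fields\<close>

lemma no_bounded_orbit_imp_uniformly_hyperbolic:
  assumes "\<not> (\<exists>\<omega>\<in>\<Omega>. \<exists>v. norm v = 1 \<and> (\<forall>n. norm (\<Phi> n \<omega> *v v) \<le> 1))"
  shows "uniformly_hyperbolic \<Omega> T A"
proof -
  obtain N \<mu> where N: "N > 0" and mu: "\<mu> > 1"
    and esc: "\<And>\<omega> v. \<omega> \<in> \<Omega> \<Longrightarrow> \<exists>n. \<bar>n\<bar> \<le> int N \<and> norm (\<Phi> n \<omega> *v v) \<ge> \<mu> * norm v"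
    using uniform_escape[OF assms] by metis
  obtain D where D: "D > 0"
    and bdd: "\<And>n \<omega> v. \<bar>n\<bar> \<le> int N \<Longrightarrow> \<omega> \<in> \<Omega> \<Longrightarrow> norm (\<Phi> n \<omega> *v v) \<le> D * norm v"
    using uniformly_bounded_\<Phi>[of "int N"] by metis
  have orbit: "no_local_max_orbit (\<lambda>n. \<Phi> (\<sigma> * n) \<omega>) N \<mu> D"
    if \<omega>: "\<omega> \<in> \<Omega>" and \<sigma>: "\<sigma> = 1 \<or> \<sigma> = -1" for \<omega> \<sigma>
  proof
    fix k l :: int and v :: "real^2"
    show "\<exists>l. \<bar>l - k\<bar> \<le> int N \<and> norm (\<Phi> (\<sigma> * l) \<omega> *v v) \<ge> \<mu> * norm (\<Phi> (\<sigma> * k) \<omega> *v v)"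
    proof -
      obtain n where n: "\<bar>n\<bar> \<le> int N" "norm (\<Phi> n (iter (\<sigma> * k) \<omega>) *v (\<Phi> (\<sigma> * k) \<omega> *v v)) \<ge>
          \<mu> * norm (\<Phi> (\<sigma> * k) \<omega> *v v)"
        using esc[OF iter_in[OF \<omega>]] by blast
      \<comment> \<open>As \<open>\<sigma> * \<sigma> = 1\<close>, a jump by \<open>n\<close> in
        original time is a jump by \<open>\<sigma> * n\<close> in the possibly reversed
        time.\<close>
      have "\<sigma> * (\<sigma> * n + k) = n + \<sigma> * k" using \<sigma> by auto
      with n show ?thesis
        using \<sigma> by (intro exI[of _ "\<sigma> * n + k"]) (auto simp: \<Phi>_add[OF \<omega>])
    qed
    show "norm (\<Phi> (\<sigma> * l) \<omega> *v v) \<le> D * norm (\<Phi> (\<sigma> * k) \<omega> *v v)" if "\<bar>l - k\<bar> \<le> int N"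
    proof -
      have "\<bar>\<sigma> * (l - k)\<bar> \<le> int N" using that \<sigma> by auto
      from bdd[OF this iter_in[OF \<omega>, of "\<sigma> * k"], of "\<Phi> (\<sigma> * k) \<omega> *v v"]
      show ?thesis by (simp add: \<Phi>_add[OF \<omega>] algebra_simps)
    qed
  qed (use N mu D in \<open>simp_all add: det_\<Phi> \<Phi>_0 \<omega>\<close>)
  \<comment> \<open>\<open>S 1\<close> will be the stable field and \<open>S (-1)\<close> the
    unstable one.\<close>
  define S where "S \<sigma> \<omega> = no_local_max_orbit.stable (\<lambda>n. \<Phi> (\<sigma> * n) \<omega>)" for \<sigma> \<omega>
  define l where "l = no_local_max_orbit.rate N \<mu>"
  have S_iff: "v \<in> S \<sigma> \<omega> \<longleftrightarrow> (\<lambda>n. \<Phi> (\<sigma> * int n) \<omega> *v v) \<longlonglongrightarrow> 0"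
    if "\<omega> \<in> \<Omega>" "\<sigma> = 1 \<or> \<sigma> = -1" for \<sigma> \<omega> v
    unfolding S_def no_local_max_orbit.stable_def[OF orbit[OF that]] by simp
  have S_RP1: "S \<sigma> \<omega> \<in> RP1" if "\<omega> \<in> \<Omega>" "\<sigma> = 1 \<or> \<sigma> = -1" for \<sigma> \<omega>
    unfolding S_def by (rule no_local_max_orbit.stable_in_RP1[OF orbit[OF that]])
  have S_dec: "norm (\<Phi> (\<sigma> * n) \<omega> *v v) \<le> D * \<mu> * l powi (- n)"
    if "\<omega> \<in> \<Omega>" "\<sigma> = 1 \<or> \<sigma> = -1" "v \<in> S \<sigma> \<omega>" "norm v = 1" "n \<ge> 1" for \<sigma> \<omega> v n
    using no_local_max_orbit.stable_decay[OF orbit[OF that(1,2)] that(3)[unfolded S_def], of "nat n"] that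
    by (simp add: l_def)
  have A_in_S: "A \<omega> *v v \<in> S \<sigma> (T \<omega>) \<longleftrightarrow> v \<in> S \<sigma> \<omega>"
    if \<omega>: "\<omega> \<in> \<Omega>" and \<sigma>: "\<sigma> = 1 \<or> \<sigma> = -1" for \<omega> v \<sigma>
  proof -
    have step: "\<Phi> m (T \<omega>) *v (A \<omega> *v v) = \<Phi> (m + 1) \<omega> *v v" for m
      using \<Phi>_add[OF \<omega>, of m 1 v] iter_Suc[OF \<omega>, of 0] \<Phi>_Suc[OF \<omega>, of 0]
      by (simp add: iter_0 \<Phi>_0)
    \<comment> \<open>Moving the base point to \<open>T \<omega>\<close> shifts time by one, which
      does not affect the limit in either direction.\<close>
    have "(\<lambda>n. \<Phi> (\<sigma> * int n + 1) \<omega> *v v) \<longlonglongrightarrow> 0 \<longleftrightarrow> (\<lambda>n. \<Phi> (\<sigma> * int n) \<omega> *v v) \<longlonglongrightarrow> 0"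
      using \<sigma>
    proof
      assume "\<sigma> = 1"
      then show ?thesis
        using filterlim_sequentially_Suc[of "\<lambda>n. \<Phi> (int n) \<omega> *v v"] by (simp add: add.commute)
    next
      assume "\<sigma> = -1"
      then show ?thesis
        using filterlim_sequentially_Suc[of "\<lambda>n. \<Phi> (1 - int n) \<omega> *v v"] by simp
    qed
    then show ?thesis using \<omega> \<sigma> by (simp add: S_iff T_in step)
  qed
  have S_inv: "proj_action (A \<omega>) (S \<sigma> \<omega>) = S \<sigma> (T \<omega>)"
    if \<omega>: "\<omega> \<in> \<Omega>" and \<sigma>: "\<sigma> = 1 \<or> \<sigma> = -1" for \<omega> \<sigma>
  proof -
    have "w = A \<omega> *v (matrix_inv (A \<omega>) *v w)" for w
      using SL2_inv(1)[OF det_A[OF \<omega>]] by (simp add: matrix_vector_mul_assoc)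
    then have "w \<in> proj_action (A \<omega>) (S \<sigma> \<omega>)" if "w \<in> S \<sigma> (T \<omega>)" for w
      using A_in_S[OF \<omega> \<sigma>] that unfolding proj_action_def image_iff by metis
    then show ?thesis using A_in_S[OF \<omega> \<sigma>] by (auto simp: proj_action_def)
  qed
  show ?thesis
  \<comment> \<open>\<open>l > 1\<close> is drawn from an actual orbit, so empty
    \<open>\<Omega>\<close> is treated apart; there all conditions are vacuous and any admissible
    constants serve.\<close>
  proof (cases "\<Omega> = {}")
    case True
    then show ?thesis by (auto simp: uniformly_hyperbolic_def intro: exI[of _ 1] exI[of _ 2])
  next
    case False
    then obtain \<omega> where "\<omega> \<in> \<Omega>" by blast
    have "l > 1"
      unfolding l_def using no_local_max_orbit.rate_gt_1[OF orbit[OF \<open>\<omega> \<in> \<Omega>\<close>, of 1]] by simp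
    moreover have "D * \<mu> > 0" using D mu by simp
    ultimately show ?thesis
      unfolding uniformly_hyperbolic_def
      using S_RP1 S_inv S_dec[of _ 1] S_dec[of _ "-1"]
      by (intro bexI[of _ "S (-1)"] bexI[of _ "S 1"] conjI exI[of _ "D * \<mu>"] exI[of _ l])
        (auto simp: Pi_iff)
  qed
qed

end

theorem theorem2:
  fixes \<Omega> :: "'a::metric_space set"
    and T :: "'a \<Rightarrow> 'a"
    and A :: "'a \<Rightarrow> real^2^2"
  assumes "compact \<Omega>"
    and "\<exists>T'. homeomorphism \<Omega> \<Omega> T T'"
    and "continuous_on \<Omega> A"
    and "A \<in> \<Omega> \<rightarrow> SL2"
  shows "\<not> uniformly_hyperbolic \<Omega> T A \<longleftrightarrow>
    (\<exists>\<omega>\<in>\<Omega>. \<exists>v :: real^2. norm v = 1 \<and> (\<forall>n::int. norm (cocycle \<Omega> T A n \<omega> *v v) \<le> 1))"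
proof -
  obtain T' where T': "homeomorphism \<Omega> \<Omega> T T'" using assms(2) by blast
  have bij: "bij_betw T \<Omega> \<Omega>"
    by (rule bij_betwI[of _ _ _ T']) (use T' in \<open>auto simp: homeomorphism_def\<close>)
  \<comment> \<open>\<open>cocycle\<close> runs backwards by \<open>inv_into \<Omega> T\<close>; its
    agreement with \<open>T'\<close> on \<open>\<Omega>\<close> transfers continuity of the
    inverse.\<close>
  have inv: "T' x = inv_into \<Omega> T x" if "x \<in> \<Omega>" for x
    using T' bij that inv_into_f_eq[of T \<Omega> "T' x" x] unfolding homeomorphism_def bij_betw_def
    by (metis image_eqI)
  interpret continuous_sl2_cocycle \<Omega> T A
  proof
    show "continuous_on \<Omega> T" using T' by (simp add: homeomorphism_def)
    have "continuous_on \<Omega> T'" using T' by (simp add: homeomorphism_def)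
    then show "continuous_on \<Omega> (inv_into \<Omega> T)" by (rule continuous_on_eq) (rule inv)
  qed (use assms bij in auto)
  show ?thesis
    using no_bounded_orbit_imp_uniformly_hyperbolic uniformly_hyperbolic_imp_no_bounded_orbit
    by (metis norm_zero zero_neq_one)
qed

end
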